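(* Let $G$ be a connected graph of order $n\ge 2$ with $m$ edges, maximum degree $\Delta$ and minimum degree $\delta$. Then $$\Big(1+\frac{\delta}{\sqrt{\Delta^2+\delta^2}+\Delta}\Big)\,m\leq HSO(G)\leq \Big(\frac{\Delta}{\delta}+\sqrt{2}-1\Big)\,m,$$ and each of the two equalities holds if and only if $G$ is a regular graph.
   Context: All graphs are finite, simple and connected. For a graph $G$ with edge set $E(G)$, $d_i$ denotes the degree of the vertex $v_i$, and the Hyperbolic Sombor index is $HSO(G)=\sum_{v_iv_j\in E(G)}\frac{\sqrt{d_i^2+d_j^2}}{\min\{d_i,d_j\}}$. A graph is regular if its maximum and minimum degrees coincide. *)

theory Defs
  imports Complex_Main "Graph_Theory.Graph_Theory"
begin

text \<open>
  Finite simple graphs are taken from \<^theory>\<open>Graph_Theory.Digraph\<close>: the locale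
  \<^locale>\<open>graph\<close> describes finite symmetric digraphs without loops and multiple arcs.
  An undirected edge is there a pair of opposite arcs, so edges have to be counted as unordered
  pairs of ends (each edge once), not as arcs.
\<close>

definition edges :: "('a, 'b) pre_digraph \<Rightarrow> 'a set set" where
  "edges G = (\<lambda>a. {tail G a, head G a}) ` arcs G"

text \<open>
  The degree of a vertex is its \<^const>\<open>out_degree\<close>; the following fact confirms that
  this is the number of incident edges.
\<close>

lemma (in graph) out_degree_eq_card_incident_edges:
  "out_degree G v = card {e \<in> edges G. v \<in> e}"
proof -
  let ?ends = "\<lambda>a. {tail G a, head G a}"
  have "inj_on ?ends (out_arcs G v)"
  proof (rule inj_onI)
    fix a b assume a: "a \<in> out_arcs G v" and b: "b \<in> out_arcs G v" and eq: "?ends a = ?ends b"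
    then have "tail G a = v" "tail G b = v" "a \<in> arcs G" "b \<in> arcs G" by auto
    moreover from this eq have "head G a = head G b" by (auto simp: doubleton_eq_iff)
    ultimately show "a = b" by (intro no_multi_arcs) (auto simp: arc_to_ends_def)
  qed
  moreover have "?ends ` out_arcs G v = {e \<in> edges G. v \<in> e}"
  proof (intro equalityI subsetI)
    fix e assume "e \<in> ?ends ` out_arcs G v"
    then show "e \<in> {e \<in> edges G. v \<in> e}" by (auto simp: edges_def)
  next
    fix e assume "e \<in> {e \<in> edges G. v \<in> e}"
    then obtain a where a: "a \<in> arcs G" "e = ?ends a" "v = tail G a \<or> v = head G a"
      by (auto simp: edges_def)
    obtain b where b: "b \<in> arcs G" "tail G a = head G b" "head G a = tail G b"
      using sym_arcs a(1) unfolding symmetric_conv by blast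
    show "e \<in> ?ends ` out_arcs G v"
    proof (cases "v = tail G a")
      case True
      with a show ?thesis by auto
    next
      case False
      with a b have "b \<in> out_arcs G v" "e = ?ends b" by auto
      then show ?thesis by blast
    qed
  qed
  ultimately show ?thesis unfolding out_degree_def by (metis card_image)
qed

definition max_degree :: "('a, 'b) pre_digraph \<Rightarrow> nat" where
  "max_degree G = Max (out_degree G ` verts G)"

definition min_degree :: "('a, 'b) pre_digraph \<Rightarrow> nat" where
  "min_degree G = Min (out_degree G ` verts G)"

definition regular :: "('a, 'b) pre_digraph \<Rightarrow> bool" where
  "regular G \<longleftrightarrow> max_degree G = min_degree G"

text \<open>
  An edge \<open>e = {u, v}\<close> has \<open>u \<noteq> v\<close>, so the inner sum is \<open>d(u)^2 + d(v)^2\<close> and the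
  denominator is \<open>min (d(u)) (d(v))\<close>.
\<close>

definition hyperbolic_sombor :: "('a, 'b) pre_digraph \<Rightarrow> real" where
  "hyperbolic_sombor G =
     (\<Sum>e\<in>edges G. sqrt (\<Sum>v\<in>e. (real (out_degree G v))\<^sup>2) / real (Min (out_degree G ` e)))"

end

theory Submission
  imports Defs
begin

text \<open>
  An edge whose ends have degrees \<open>a \<le> b\<close> contributes \<open>sqrt (1 + t^2)\<close> to the index, where
  \<open>t = b / a\<close> lies between \<open>1\<close> and \<open>T = \<Delta> / \<delta>\<close>.  Both bounds come from the single function
  \<open>g t = sqrt (1 + t^2) - t\<close>, which is strictly decreasing
  (\<open>sqrt_one_plus_square_minus_strict_antimono\<close>).  Rationalising the fraction
  turns the lower constant into \<open>1 + g T\<close>, and the upper constant is \<open>T + g 1\<close>.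
  Therefore
  \<open>1 + g T \<le> 1 + g 1 = sqrt 2 \<le> sqrt (1 + t^2) = t + g t \<le> T + g 1\<close>.

  If \<open>T > 1\<close>, both bounds are strict on every single edge: below because \<open>g T < g 1\<close>, above
  because \<open>t < T\<close> or \<open>g t < g 1\<close>.  Since a connected graph with at least two vertices has an edge, they
  stay strict after summation.  If \<open>T = 1\<close>, the two constants agree, so that the bounds force
  both equalities.
\<close>

text \<open>
  The curve \<open>sqrt (1 + t^2)\<close> is a branch of a hyperbola with asymptote \<open>t\<close>, whose slope is always
  below \<open>1\<close>.  The proof squares the inequality \<open>sqrt (1 + t^2) < sqrt (1 + s^2) + (t - s)\<close>, which
  then reduces to \<open>s < sqrt (1 + s^2)\<close>.
\<close>

lemma sqrt_one_plus_square_minus_strict_antimono: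
  fixes s t :: real
  assumes "s < t"
  shows "sqrt (1 + t\<^sup>2) - t < sqrt (1 + s\<^sup>2) - s"
proof -
  have "s < sqrt (1 + s\<^sup>2)"
    by (rule real_less_rsqrt) simp
  with assms have "2 * ((t - s) * s) < 2 * ((t - s) * sqrt (1 + s\<^sup>2))"
    by simp
  then have "1 + t\<^sup>2 < 1 + s\<^sup>2 + 2 * ((t - s) * sqrt (1 + s\<^sup>2)) + (t - s)\<^sup>2"
    by (simp add: power2_eq_square algebra_simps)
  also have "\<dots> = (sqrt (1 + s\<^sup>2) + (t - s))\<^sup>2"
    by (simp add: power2_sum)
  finally have "sqrt (1 + t\<^sup>2) < sqrt (1 + s\<^sup>2) + (t - s)"
    using assms by (intro real_less_lsqrt) auto
  then show ?thesis by simp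
qed

text \<open>
  Multiplying numerator and denominator by \<open>sqrt (D^2 + d^2) - D\<close> makes the denominator \<open>d^2\<close>.
\<close>

lemma divide_sqrt_sum_squares_plus:
  fixes D d :: real
  assumes "0 < d" "0 \<le> D"
  shows "d / (sqrt (D\<^sup>2 + d\<^sup>2) + D) = sqrt (1 + (D / d)\<^sup>2) - D / d"
proof -
  let ?r = "sqrt (D\<^sup>2 + d\<^sup>2)"
  have pos: "0 < ?r + D"
    using assms by (intro add_pos_nonneg) (auto intro: add_nonneg_pos)
  have "1 + (D / d)\<^sup>2 = (D\<^sup>2 + d\<^sup>2) / d\<^sup>2"
    using assms by (simp add: field_simps)
  then have root: "sqrt (1 + (D / d)\<^sup>2) = ?r / d"
    using assms by (simp add: real_sqrt_divide)
  have "(?r - D) * (?r + D) = d * d"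
    by (simp add: algebra_simps flip: power2_eq_square)
  then have "d / (?r + D) = (?r - D) / d"
    using assms pos by (simp add: frac_eq_eq)
  then show ?thesis
    by (simp add: root diff_divide_distrib)
qed

lemma sombor_term_eq_sqrt_ratio:
  fixes a b d D :: real
  assumes "0 < d" "d \<le> a" "d \<le> b" "a \<le> D" "b \<le> D"
  obtains t where "1 \<le> t" "t \<le> D / d" "sqrt (a\<^sup>2 + b\<^sup>2) / min a b = sqrt (1 + t\<^sup>2)"
proof
  let ?l = "min a b" and ?u = "max a b"
  have l: "0 < ?l" "d \<le> ?l" "?u \<le> D" "?l \<le> ?u"
    using assms by auto
  show "1 \<le> ?u / ?l"
    using l by simp
  show "?u / ?l \<le> D / d"
    using l assms by (intro frac_le) auto
  have "a\<^sup>2 + b\<^sup>2 = ?l\<^sup>2 + ?u\<^sup>2"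
    by (simp add: min_def max_def)
  then have "(a\<^sup>2 + b\<^sup>2) / ?l\<^sup>2 = 1 + (?u / ?l)\<^sup>2"
    using less_imp_neq[OF l(1)] by (simp add: add_divide_distrib power_divide)
  moreover have "sqrt ((a\<^sup>2 + b\<^sup>2) / ?l\<^sup>2) = sqrt (a\<^sup>2 + b\<^sup>2) / ?l"
    using l(1) by (simp only: real_sqrt_divide real_sqrt_abs abs_of_pos)
  ultimately show "sqrt (a\<^sup>2 + b\<^sup>2) / ?l = sqrt (1 + (?u / ?l)\<^sup>2)"
    by simp
qed

text \<open>
  These are the bounds for one edge of degree ratio \<open>t\<close>; \<open>T\<close> is the largest ratio that the degree
  range permits.  The upper bound adds up \<open>t \<le> T\<close> and
  \<open>g t \<le> g 1\<close>, where \<open>g x = sqrt (1 + x^2) - x\<close>.  Equality in the first needs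
  \<open>t = T\<close> and in the second \<open>t = 1\<close>, so that for \<open>1 < T\<close> at least one of them is strict.
\<close>

lemma sqrt_one_plus_square_bounds:
  fixes t T :: real
  assumes "1 \<le> t" "t \<le> T"
  shows "1 + (sqrt (1 + T\<^sup>2) - T) \<le> sqrt (1 + t\<^sup>2)"
    and "sqrt (1 + t\<^sup>2) \<le> T + sqrt 2 - 1"
    and "1 < T \<Longrightarrow> 1 + (sqrt (1 + T\<^sup>2) - T) < sqrt (1 + t\<^sup>2)"
    and "1 < T \<Longrightarrow> sqrt (1 + t\<^sup>2) < T + sqrt 2 - 1"
proof -
  have g1: "sqrt (1 + x\<^sup>2) - x < sqrt 2 - 1" if "1 < x" for x :: real
    using sqrt_one_plus_square_minus_strict_antimono[OF that] by simp
  have sqrt2: "sqrt 2 \<le> sqrt (1 + t\<^sup>2)"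
    using assms by simp
  show below: "1 + (sqrt (1 + T\<^sup>2) - T) < sqrt (1 + t\<^sup>2)" if "1 < T"
    using g1[OF that] sqrt2 by linarith
  show above: "sqrt (1 + t\<^sup>2) < T + sqrt 2 - 1" if "1 < T"
  proof (cases "t = 1")
    case False
    with assms have "1 < t" by simp
    from g1[OF this] assms show ?thesis by linarith
  qed (use that in simp)
  have "T = 1 \<and> t = 1 \<or> 1 < T"
    using assms by linarith
  then show "1 + (sqrt (1 + T\<^sup>2) - T) \<le> sqrt (1 + t\<^sup>2)"
    and "sqrt (1 + t\<^sup>2) \<le> T + sqrt 2 - 1"
    using below above by (auto intro: less_imp_le)
qed

lemma (in fin_digraph) degree_bounds:
  assumes "v \<in> verts G"
  shows "min_degree G \<le> out_degree G v" "out_degree G v \<le> max_degree G"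
  using assms unfolding min_degree_def max_degree_def by auto

text \<open>
  A path from a vertex to any other vertex leaves the former along an arc.  This keeps the
  denominators of the index positive, and it also provides an edge.
\<close>

lemma (in graph) connected_imp_out_degree_pos:
  assumes "connected G" "2 \<le> card (verts G)" "v \<in> verts G"
  shows "0 < out_degree G v"
proof -
  have "verts G \<noteq> {v}"
    using assms(2) by auto
  then obtain w where w: "w \<in> verts G" "w \<noteq> v"
    using assms(3) by blast
  have "strongly_connected G"
    using assms(1) sym_arcs by (rule symmetric_connected_imp_strongly_connected[rotated])
  then have "v \<rightarrow>\<^sup>*\<^bsub>G\<^esub> w"
    using assms(3) w(1) by auto
  then obtain x where "v \<rightarrow>\<^bsub>G\<^esub> x"
    using w(2) by (cases rule: converse_reachable_cases) auto
  then have "out_arcs G v \<noteq> {}"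
    by (auto simp: arcs_ends_def arc_to_ends_def)
  then show ?thesis
    by (simp add: out_degree_def card_gt_0_iff finite_out_arcs)
qed

lemma (in graph) edge_contribution_eq_sqrt_ratio:
  assumes "0 < min_degree G" "e \<in> edges G"
  obtains t where "1 \<le> t" "t \<le> real (max_degree G) / real (min_degree G)"
    "sqrt (\<Sum>v\<in>e. (real (out_degree G v))\<^sup>2) / real (Min (out_degree G ` e)) = sqrt (1 + t\<^sup>2)"
proof -
  obtain a where a: "a \<in> arcs G" "e = {tail G a, head G a}"
    using assms(2) by (auto simp: edges_def)
  let ?p = "out_degree G (tail G a)" and ?q = "out_degree G (head G a)"
  have verts: "tail G a \<in> verts G" "head G a \<in> verts G"
    using a(1) by auto
  have "tail G a \<noteq> head G a"
    using a(1) by (rule no_loops)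
  then have "(\<Sum>v\<in>e. (real (out_degree G v))\<^sup>2) = (real ?p)\<^sup>2 + (real ?q)\<^sup>2"
    by (simp add: a(2))
  moreover have "real (Min (out_degree G ` e)) = min (real ?p) (real ?q)"
    by (simp add: a(2) of_nat_min)
  ultimately show ?thesis
    using sombor_term_eq_sqrt_ratio[of "real (min_degree G)" "real ?p" "real ?q" "real (max_degree G)"]
      degree_bounds[OF verts(1)] degree_bounds[OF verts(2)] assms(1) that
    by auto
qed

theorem theorem4p1:
  fixes G :: "('a, 'b) pre_digraph" and n m \<Delta> \<delta> :: nat
  assumes "graph G"
    and "Digraph_Component.connected G"
    and "n = card (verts G)" and "n \<ge> 2"
    and "m = card (edges G)"
    and "\<Delta> = max_degree G" and "\<delta> = min_degree G"
  shows "(1 + real \<delta> / (sqrt ((real \<Delta>)\<^sup>2 + (real \<delta>)\<^sup>2) + real \<Delta>)) * real m \<le> hyperbolic_sombor G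
    \<and> hyperbolic_sombor G \<le> (real \<Delta> / real \<delta> + sqrt 2 - 1) * real m
    \<and> ((1 + real \<delta> / (sqrt ((real \<Delta>)\<^sup>2 + (real \<delta>)\<^sup>2) + real \<Delta>)) * real m = hyperbolic_sombor G
         \<longleftrightarrow> regular G)
    \<and> (hyperbolic_sombor G = (real \<Delta> / real \<delta> + sqrt 2 - 1) * real m \<longleftrightarrow> regular G)"
proof -
  interpret graph G by fact
  let ?f = "\<lambda>e. sqrt (\<Sum>v\<in>e. (real (out_degree G v))\<^sup>2) / real (Min (out_degree G ` e))"
  define T where "T = real \<Delta> / real \<delta>"
  let ?L = "1 + (sqrt (1 + T\<^sup>2) - T)" and ?U = "T + sqrt 2 - 1"
  have "verts G \<noteq> {}"
    using assms(3,4) by auto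
  then obtain v where v: "v \<in> verts G"
    by blast
  have pos: "0 < out_degree G u" if "u \<in> verts G" for u
    using connected_imp_out_degree_pos assms(2-4) that by simp
  have \<delta>_pos: "0 < \<delta>"
    using pos \<open>verts G \<noteq> {}\<close> by (simp add: assms(7) min_degree_def)
  have "\<delta> \<le> \<Delta>"
    using degree_bounds[OF v] assms(6,7) by simp
  have "out_arcs G v \<noteq> {}"
    using pos[OF v] by (auto simp: out_degree_def)
  then have edges_ne: "edges G \<noteq> {}"
    by (auto simp: edges_def out_arcs_def)
  have edges_fin: "finite (edges G)"
    by (simp add: edges_def)
  have H: "hyperbolic_sombor G = sum ?f (edges G)"
    by (simp add: hyperbolic_sombor_def)
  have const: "(\<Sum>e\<in>edges G. c) = c * real m" for c :: real
    by (simp add: assms(5))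
  have lower_const: "1 + real \<delta> / (sqrt ((real \<Delta>)\<^sup>2 + (real \<delta>)\<^sup>2) + real \<Delta>) = ?L"
    using divide_sqrt_sum_squares_plus[of "real \<delta>" "real \<Delta>"] \<delta>_pos by (simp add: T_def)
  have edge: "?L \<le> ?f e" "?f e \<le> ?U" "1 < T \<Longrightarrow> ?L < ?f e" "1 < T \<Longrightarrow> ?f e < ?U"
    if e: "e \<in> edges G" for e
  proof -
    obtain t where t: "1 \<le> t" "t \<le> T" "?f e = sqrt (1 + t\<^sup>2)"
      using edge_contribution_eq_sqrt_ratio[OF _ e] \<delta>_pos assms(6,7) unfolding T_def by metis
    show "?L \<le> ?f e" "?f e \<le> ?U" "1 < T \<Longrightarrow> ?L < ?f e" "1 < T \<Longrightarrow> ?f e < ?U"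
      unfolding t(3) using sqrt_one_plus_square_bounds[OF t(1,2)] by auto
  qed
  have lower: "?L * real m \<le> hyperbolic_sombor G"
    unfolding H const[symmetric] by (intro sum_mono edge)
  have upper: "hyperbolic_sombor G \<le> ?U * real m"
    unfolding H const[symmetric] by (intro sum_mono edge)
  have equalities: "(?L * real m = hyperbolic_sombor G \<longleftrightarrow> regular G)
    \<and> (hyperbolic_sombor G = ?U * real m \<longleftrightarrow> regular G)"
  proof (cases "\<Delta> = \<delta>")
    case True
    then have "regular G"
      using assms(6,7) by (simp add: regular_def)
    moreover have "T = 1"
      using True \<delta>_pos by (simp add: T_def)
    \<comment> \<open>At \<open>T = 1\<close> both constants are \<open>sqrt 2\<close>.\<close>
    ultimately show ?thesis
      using lower upper by simp
  next
    case False
    then have "\<not> regular G"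
      using assms(6,7) by (simp add: regular_def)
    moreover have "1 < T"
      using False \<open>\<delta> \<le> \<Delta>\<close> \<delta>_pos by (simp add: T_def)
    have "?L * real m < hyperbolic_sombor G"
      unfolding H const[symmetric] by (rule sum_strict_mono[OF edges_fin edges_ne edge(3)[OF _ \<open>1 < T\<close>]])
    moreover have "hyperbolic_sombor G < ?U * real m"
      unfolding H const[symmetric] by (rule sum_strict_mono[OF edges_fin edges_ne edge(4)[OF _ \<open>1 < T\<close>]])
    ultimately show ?thesis
      by simp
  qed
  show ?thesis
    using lower upper equalities unfolding lower_const T_def[symmetric] by blast
qed

end
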